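(* Let $m,n\ge 1$ be integers and let $c=(a_1,\ldots,a_{m-1},-;b_1,\ldots,b_n)$ be a stable configuration of the Abelian sandpile model on the complete split graph $S_{m,n}$ with sink the clique vertex $v_m$ (here $a_i$ is the number of grains at $v_i$ and $b_j$ the number of grains at $w_j$). Suppose $c$ is weakly decreasing, i.e. $a_1\ge\cdots\ge a_{m-1}$ and $b_1\ge\cdots\ge b_n$. Then $c$ is recurrent if and only if there is a unique Motzkin word $\alpha\in\mathsf{Motzkin}_{m-1,n}$ such that $f(\alpha)=c$.
   Context: The complete split graph $S_{m,n}$ has clique vertices $v_1,\ldots,v_m$ and independent vertices $w_1,\ldots,w_n$. Every two distinct clique vertices are joined by one edge, every clique vertex is joined to every independent vertex by one edge, and no two independent vertices are adjacent. Abelian sandpile model on a graph $G$ with sink $s$: a configuration assigns a non-negative integer (number of grains) to each non-sink vertex. A non-sink vertex $v$ is stable if its number of grains is strictly less than $\deg(v)$, and unstable otherwise. A configuration is stable if all non-sink vertices are stable. An unstable vertex may topple, i.e. it loses $\deg(v)$ grains and gives one grain to each neighbour; grains given to the sink disappear. Toppling unstable vertices eventually leads to a unique stable configuration, the stabilisation. A stable configuration $c$ is recurrent if it can be reached, by adding grains and toppling, from every configuration: for every configuration $d$ there is a configuration $e$ such that the stabilisation of $d+e$ is $c$. A Motzkin word is a word in the letters $U,D,H$ such that every prefix contains at least as many $U$'s as $D$'s, and the total numbers of $U$'s and $D$'s are equal. $\mathsf{Motzkin}_{p,q}$ is the set of Motzkin words with exactly $p$ letters $U$ and $q$ letters $H$.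 For $\alpha\in\mathsf{Motzkin}_{m-1,n}$, the configuration $f(\alpha)=(a_1,\ldots,a_{m-1},-;b_1,\ldots,b_n)$ is defined by: $a_i+1$ is the number of letters of $\alpha$ equal to $D$ or $H$ appearing after the $i$-th occurrence of $U$; $b_i$ is the number of letters $D$ appearing after the $i$-th occurrence of $H$ in $\alpha$. The dash marks the sink and the semicolon separates clique from independent vertices. *)

theory Defs
  imports Main "HOL-Library.Sublist"
begin

section \<open>The Abelian sandpile model on a simple graph\<close>

text \<open>A simple graph is a pair of a vertex set and a set of edges, each edge being a
  two-element set of vertices.\<close>

type_synonym 'v sgraph = "'v set \<times> 'v set set"

definition neighbours :: "'v sgraph \<Rightarrow> 'v \<Rightarrow> 'v set" where
  "neighbours G v = {u \<in> fst G. {v, u} \<in> snd G}"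

definition vdeg :: "'v sgraph \<Rightarrow> 'v \<Rightarrow> nat" where
  "vdeg G v = card (neighbours G v)"

text \<open>A configuration only carries information on the non-sink vertices. It is encoded as a
  function that is 0 everywhere else (in particular at the sink), so that equality of
  configurations is equality of functions.\<close>

definition configuration :: "'v sgraph \<Rightarrow> 'v \<Rightarrow> ('v \<Rightarrow> nat) \<Rightarrow> bool" where
  "configuration G s c \<longleftrightarrow> (\<forall>v. v \<notin> fst G - {s} \<longrightarrow> c v = 0)"

definition stable_config :: "'v sgraph \<Rightarrow> 'v \<Rightarrow> ('v \<Rightarrow> nat) \<Rightarrow> bool" where
  "stable_config G s c \<longleftrightarrow> configuration G s c \<and> (\<forall>v \<in> fst G - {s}. c v < vdeg G v)"

definition topple :: "'v sgraph \<Rightarrow> 'v \<Rightarrow> 'v \<Rightarrow> ('v \<Rightarrow> nat) \<Rightarrow> 'v \<Rightarrow> nat" where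
  "topple G s v c = (\<lambda>u. if u = v then c u - vdeg G v
                         else if u \<in> neighbours G v - {s} then c u + 1
                         else c u)"

definition topples_to :: "'v sgraph \<Rightarrow> 'v \<Rightarrow> ('v \<Rightarrow> nat) \<Rightarrow> ('v \<Rightarrow> nat) \<Rightarrow> bool" where
  "topples_to G s c c' \<longleftrightarrow> (\<exists>v \<in> fst G - {s}. vdeg G v \<le> c v \<and> c' = topple G s v c)"

text \<open>\<open>stabilises_to G s c c'\<close> says that \<open>c'\<close> is the stabilisation of \<open>c\<close>: a stable
  configuration obtained from \<open>c\<close> by a finite sequence of topplings of unstable vertices.
  (That there is at most one such \<open>c'\<close> is the Abelian property of the model.)\<close>

definition stabilises_to :: "'v sgraph \<Rightarrow> 'v \<Rightarrow> ('v \<Rightarrow> nat) \<Rightarrow> ('v \<Rightarrow> nat) \<Rightarrow> bool" where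
  "stabilises_to G s c c' \<longleftrightarrow> (topples_to G s)\<^sup>*\<^sup>* c c' \<and> stable_config G s c'"

definition recurrent_config :: "'v sgraph \<Rightarrow> 'v \<Rightarrow> ('v \<Rightarrow> nat) \<Rightarrow> bool" where
  "recurrent_config G s c \<longleftrightarrow> stable_config G s c \<and>
     (\<forall>d. configuration G s d \<longrightarrow>
        (\<exists>e. configuration G s e \<and> stabilises_to G s (\<lambda>v. d v + e v) c))"

section \<open>The complete split graph\<close>

datatype vertex = Clique nat | Indep nat

definition split_graph :: "nat \<Rightarrow> nat \<Rightarrow> vertex sgraph" where
  "split_graph m n =
     (Clique ` {1..m} \<union> Indep ` {1..n},
      {{Clique i, Clique j} | i j. i \<in> {1..m} \<and> j \<in> {1..m} \<and> i \<noteq> j} \<union>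
      {{Clique i, Indep j} | i j. i \<in> {1..m} \<and> j \<in> {1..n}})"

definition weakly_decreasing :: "nat \<Rightarrow> nat \<Rightarrow> (vertex \<Rightarrow> nat) \<Rightarrow> bool" where
  "weakly_decreasing m n c \<longleftrightarrow>
     antimono_on {1..m - 1} (\<lambda>i. c (Clique i)) \<and> antimono_on {1..n} (\<lambda>j. c (Indep j))"

section \<open>Motzkin words\<close>

datatype letter = U | D | H

definition motzkin_word :: "letter list \<Rightarrow> bool" where
  "motzkin_word w \<longleftrightarrow>
     (\<forall>p. prefix p w \<longrightarrow> count_list p D \<le> count_list p U) \<and> count_list w U = count_list w D"

definition Motzkin :: "nat \<Rightarrow> nat \<Rightarrow> letter list set" where
  "Motzkin p q = {w. motzkin_word w \<and> count_list w U = p \<and> count_list w H = q}"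

text \<open>The part of a word strictly after the \<open>i\<close>-th occurrence (counted from 1) of \<open>x\<close>.\<close>

fun after_nth :: "nat \<Rightarrow> 'a \<Rightarrow> 'a list \<Rightarrow> 'a list" where
  "after_nth 0 x w = w"
| "after_nth (Suc i) x w = after_nth i x (tl (dropWhile (\<lambda>y. y \<noteq> x) w))"

text \<open>The configuration \<open>f(\<alpha>)\<close>, meant for \<open>\<alpha> \<in> Motzkin (m - 1) n\<close>. The truncated
  subtraction in the first case is harmless there, since in a Motzkin word every \<open>U\<close> is
  followed by some \<open>D\<close>.\<close>

definition motzkin_config :: "nat \<Rightarrow> nat \<Rightarrow> letter list \<Rightarrow> vertex \<Rightarrow> nat" where
  "motzkin_config m n \<alpha> v =
     (case v of
        Clique i \<Rightarrow> if i \<in> {1..m - 1}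
                    then count_list (after_nth i U \<alpha>) D + count_list (after_nth i U \<alpha>) H - 1
                    else 0
      | Indep j \<Rightarrow> if j \<in> {1..n} then count_list (after_nth j H \<alpha>) D else 0)"

end

theory Submission
  imports Defs
begin

text \<open>
  The proof reads a Motzkin word as a schedule of Dhar's burning process on the graph. The fire
  starts at the sink, and a vertex catches fire as soon as its grains are at least as many as its
  neighbours that do not burn yet. A letter \<open>D\<close> is the burning of a clique vertex, a letter \<open>H\<close>
  the burning of an independent vertex, and a letter \<open>U\<close> the moment at which a further clique
  vertex becomes able to burn. For \<open>v\<^sub>i\<close> this moment comes when at most \<open>a\<^sub>i\<close> other vertices
  are unburnt, so when \<open>a\<^sub>i + 1\<close> letters \<open>D\<close> or \<open>H\<close> remain. An independent vertex
  \<open>w\<^sub>j\<close> can burn when \<open>b\<^sub>j\<close> clique vertices are unburnt, so when \<open>b\<^sub>j\<close> letters \<open>D\<close>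
  remain, and it does so immediately. These are the equations that define the configuration of a
  word. The prefix condition of Motzkin words says that no clique vertex burns before it can.

  The argument has three parts.

  Recurrence is the absence of forbidden subconfigurations: every nonempty set of non-sink
  vertices contains a vertex with at least as many grains as it has neighbours in the set.
  Necessity is \<open>recurrent_imp_no_forbidden_subset\<close>. Sufficiency is usually deduced from the
  Abelian property, but here the sink is adjacent to all other vertices: hence adding one grain
  everywhere and toppling every vertex once, in a burning order, leads back to the start
  (\<open>burning_returns\<close>). So \<open>c\<close> is reached from \<open>c\<close> plus any constant, and these configurations
  dominate every given one. On the complete split graph the criterion only involves the numbers of
  clique and of independent vertices in the set (\<open>recurrent_split_graph_iff\<close>).

  The heights \<open>a\<close> and \<open>b\<close> determine a word. Reading from the left, the first letter is
  forced by the largest heights and by the numbers of letters still to come: this gives both the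
  uniqueness (\<open>word_eqI\<close>) and, for weakly decreasing heights within the bounds of stability, the
  existence (\<open>word_exists\<close>) of a word with these heights, whether or not it is a Motzkin word.

  Finally, this word is a Motzkin word exactly if there is no forbidden subconfiguration. In a
  Motzkin word, among the last \<open>p\<close> letters \<open>D\<close> and the last \<open>q\<close> letters \<open>H\<close> the
  leftmost one is the burning of a vertex that has enough grains (\<open>motzkin_burnable\<close>).
  Conversely, the vertices whose \<open>U\<close> or \<open>H\<close> comes after the first violation of the prefix
  condition form a forbidden subconfiguration (\<open>motzkinI\<close>).
\<close>

section \<open>Recurrence and forbidden subconfigurations\<close>

definition no_forbidden_subset :: "'v sgraph \<Rightarrow> 'v \<Rightarrow> ('v \<Rightarrow> nat) \<Rightarrow> bool" where
  "no_forbidden_subset G s c \<longleftrightarrow>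
     (\<forall>A. A \<subseteq> fst G - {s} \<longrightarrow> A \<noteq> {} \<longrightarrow> (\<exists>v\<in>A. card (neighbours G v \<inter> A) \<le> c v))"

lemma neighbours_sym:
  "v \<in> fst G \<Longrightarrow> u \<in> neighbours G v \<Longrightarrow> v \<in> neighbours G u"
  by (auto simp: neighbours_def insert_commute)

lemma finite_neighbours: "finite (fst G) \<Longrightarrow> finite (neighbours G v)"
  by (simp add: neighbours_def)

text \<open>\<open>T\<close> is the set of vertices that topple on the way from \<open>x\<close> to \<open>c\<close>; all others can only
  gain grains. In a nonempty subset of \<open>T\<close>, take the vertex whose last toppling is the earliest:
  afterwards it receives a grain from each of its neighbours in the subset.\<close>

lemma toppled_set_not_forbidden:
  assumes loopfree: "\<And>v. v \<notin> neighbours G v" and fin: "finite (fst G)"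
    and "(topples_to G s)\<^sup>*\<^sup>* x c"
  shows "\<exists>T. (\<forall>v. v \<in> fst G - {s} \<longrightarrow> v \<notin> T \<longrightarrow> x v \<le> c v) \<and>
             (\<forall>A. A \<subseteq> fst G - {s} \<longrightarrow> A \<subseteq> T \<longrightarrow> A \<noteq> {} \<longrightarrow>
                  (\<exists>v\<in>A. card (neighbours G v \<inter> A) \<le> c v))"
  using assms(3)
proof (induction rule: rtranclp_induct)
  case base
  show ?case by (rule exI[of _ "{}"]) auto
next
  case (step y z)
  obtain T where T1: "\<And>v. v \<in> fst G - {s} \<Longrightarrow> v \<notin> T \<Longrightarrow> x v \<le> y v"
    and T2: "\<And>A. A \<subseteq> fst G - {s} \<Longrightarrow> A \<subseteq> T \<Longrightarrow> A \<noteq> {} \<Longrightarrow>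
                  \<exists>v\<in>A. card (neighbours G v \<inter> A) \<le> y v"
    using step.IH by blast
  obtain w where w: "w \<in> fst G - {s}" and z: "z = topple G s w y"
    using step.hyps(2) by (auto simp: topples_to_def)
  have mono: "y v \<le> z v" if "v \<noteq> w" for v
    using that by (simp add: z topple_def)
  have "\<exists>v\<in>A. card (neighbours G v \<inter> A) \<le> z v"
    if A: "A \<subseteq> fst G - {s}" "A \<subseteq> insert w T" "A \<noteq> {}" for A
  proof (cases "A = {w}")
    case True
    then show ?thesis using loopfree[of w] by simp
  next
    case False
    \<comment> \<open>\<open>w\<close> has just toppled and may have no grains left, so the witness is sought elsewhere.\<close>
    obtain v where v: "v \<in> A - {w}" and le: "card (neighbours G v \<inter> (A - {w})) \<le> y v"
      using T2[of "A - {w}"] A False by blast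
    have "card (neighbours G v \<inter> A) \<le> z v"
    proof (cases "w \<in> neighbours G v \<inter> A")
      case True
      have "neighbours G v \<inter> A = insert w (neighbours G v \<inter> (A - {w}))"
        using True by blast
      then have "card (neighbours G v \<inter> A) = Suc (card (neighbours G v \<inter> (A - {w})))"
        using finite_neighbours[OF fin] by simp
      moreover have "v \<in> neighbours G w - {s}"
        using neighbours_sym[of v G w] True v A(1) by blast
      then have "z v = y v + 1" using v by (simp add: z topple_def)
      ultimately show ?thesis using le by simp
    next
      case False
      then have "neighbours G v \<inter> A = neighbours G v \<inter> (A - {w})" by blast
      then show ?thesis using le mono[of v] v by simp
    qed
    then show ?thesis using v by blast
  qed
  moreover have "x v \<le> z v" if "v \<in> fst G - {s}" "v \<notin> insert w T" for v
    using T1[of v] mono[of v] that by simp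
  ultimately show ?case by (intro exI[of _ "insert w T"]) blast
qed

text \<open>Starting from a configuration in which every vertex is unstable, every vertex has to topple
  before a stable configuration is reached.\<close>

lemma recurrent_imp_no_forbidden_subset:
  assumes loopfree: "\<And>v. v \<notin> neighbours G v" and fin: "finite (fst G)"
    and rec: "recurrent_config G s c"
  shows "no_forbidden_subset G s c"
proof -
  define d where "d = (\<lambda>v. if v \<in> fst G - {s} then vdeg G v else 0)"
  have "configuration G s d" by (simp add: configuration_def d_def)
  then obtain e where e: "(topples_to G s)\<^sup>*\<^sup>* (\<lambda>v. d v + e v) c"
    using rec by (auto simp: recurrent_config_def stabilises_to_def)
  obtain T where T1: "\<And>v. v \<in> fst G - {s} \<Longrightarrow> v \<notin> T \<Longrightarrow> d v + e v \<le> c v"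
    and T2: "\<And>A. A \<subseteq> fst G - {s} \<Longrightarrow> A \<subseteq> T \<Longrightarrow> A \<noteq> {} \<Longrightarrow>
                  \<exists>v\<in>A. card (neighbours G v \<inter> A) \<le> c v"
    using toppled_set_not_forbidden[OF loopfree fin e] by blast
  have "c v < vdeg G v" if "v \<in> fst G - {s}" for v
    using rec that by (auto simp: recurrent_config_def stable_config_def)
  then have "v \<in> T" if "v \<in> fst G - {s}" for v
    using T1[of v] that by (force simp: d_def)
  then have "fst G - {s} \<subseteq> T" by blast
  then show ?thesis unfolding no_forbidden_subset_def using T2 by (meson order_trans)
qed

text \<open>If every vertex topples exactly once, each \<open>v\<close> loses its degree and gains one grain from
  every neighbour except the sink. As the sink is a neighbour, the net loss is one grain, which is
  the grain added at the start. The hypothesis on \<open>c\<close> provides, in every nonempty set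
  of vertices still to topple, one that is unstable once the sink and the vertices outside the set
  have given it their grains.
  Allowing \<open>e\<close> above \<open>c\<close> makes it possible to repeat the process from larger configurations.\<close>

lemma burning_returns:
  fixes c e :: "'v \<Rightarrow> nat"
  assumes loopfree: "\<And>v. v \<notin> neighbours G v" and fin: "finite (fst G)"
    and s: "s \<in> fst G" and dominating: "fst G - {s} \<subseteq> neighbours G s"
    and nf: "no_forbidden_subset G s c"
    and ge: "\<And>v. c v \<le> e v"
  shows "(topples_to G s)\<^sup>*\<^sup>* (\<lambda>v. e v + (if v \<in> fst G - {s} then 1 else 0)) e"
proof -
  let ?V = "fst G - {s}"
  let ?start = "\<lambda>v. e v + (if v \<in> ?V then 1 else 0)"
  have deg: "vdeg G v = card (neighbours G v \<inter> (?V - B)) + card (neighbours G v \<inter> B) + 1"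
    if "v \<in> ?V" "B \<subseteq> ?V" for v B
  proof -
    have "s \<in> neighbours G v" using neighbours_sym[OF s] dominating that by blast
    then have "neighbours G v =
        insert s ((neighbours G v \<inter> (?V - B)) \<union> (neighbours G v \<inter> B))"
      using that by (auto simp: neighbours_def)
    also have "card \<dots> = Suc (card ((neighbours G v \<inter> (?V - B)) \<union> (neighbours G v \<inter> B)))"
      using finite_neighbours[OF fin, of v] that by (subst card_insert_disjoint) auto
    also have "card ((neighbours G v \<inter> (?V - B)) \<union> (neighbours G v \<inter> B)) =
        card (neighbours G v \<inter> (?V - B)) + card (neighbours G v \<inter> B)"
      using finite_neighbours[OF fin, of v] by (intro card_Un_disjoint) auto
    finally show ?thesis by (simp add: vdeg_def)
  qed
  \<comment> \<open>\<open>B\<close> is the set of vertices already toppled. The degree lost is written on the left side,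
    which avoids truncated subtraction.\<close>
  have "\<exists>B x. B \<subseteq> ?V \<and> card B = k \<and> (topples_to G s)\<^sup>*\<^sup>* ?start x \<and>
          (\<forall>v. x v + (if v \<in> B then vdeg G v else 0) =
               e v + (if v \<in> ?V then 1 + card (neighbours G v \<inter> B) else 0))"
    if "k \<le> card ?V" for k
    using that
  proof (induction k)
    case 0
    show ?case by (rule exI[of _ "{}"], rule exI[of _ ?start]) auto
  next
    case (Suc k)
    then obtain B x where B: "B \<subseteq> ?V" "card B = k" and reach: "(topples_to G s)\<^sup>*\<^sup>* ?start x"
      and x: "\<And>v. x v + (if v \<in> B then vdeg G v else 0) =
               e v + (if v \<in> ?V then 1 + card (neighbours G v \<inter> B) else 0)"
      by auto
    have "B \<noteq> ?V" using Suc.prems B(2) by auto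
    then obtain w where w: "w \<in> ?V - B"
      and burn: "card (neighbours G w \<inter> (?V - B)) \<le> c w"
      using nf B(1) unfolding no_forbidden_subset_def
      by (metis Diff_eq_empty_iff Diff_subset subset_antisym)
    have unstable: "vdeg G w \<le> x w"
      using x[of w] w burn deg[of w B] B(1) ge[of w] by simp
    have finB: "finite B" using B(1) fin finite_subset by blast
    have "(topples_to G s)\<^sup>*\<^sup>* ?start (topple G s w x)"
      using reach by (rule rtranclp.rtrancl_into_rtrancl) (use w unstable in \<open>auto simp: topples_to_def\<close>)
    moreover have "topple G s w x v + (if v \<in> insert w B then vdeg G v else 0) =
        e v + (if v \<in> ?V then 1 + card (neighbours G v \<inter> insert w B) else 0)" for v
    proof (cases "v = w")
      case True
      then show ?thesis using x[of w] w unstable loopfree[of w] by (simp add: topple_def)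
    next
      case False
      show ?thesis
      proof (cases "v \<in> ?V \<and> w \<in> neighbours G v")
        case True
        then have "v \<in> neighbours G w - {s}" using neighbours_sym[of v G w] by blast
        moreover have "card (neighbours G v \<inter> insert w B) = Suc (card (neighbours G v \<inter> B))"
          using True w finB by simp
        ultimately show ?thesis using False x[of v] True by (simp add: topple_def)
      next
        case other: False
        then have "v \<notin> neighbours G w - {s}"
          using neighbours_sym[of w G v] w by (auto simp: neighbours_def)
        then show ?thesis using False x[of v] other by (auto simp: topple_def)
      qed
    qed
    moreover have "insert w B \<subseteq> ?V" "card (insert w B) = Suc k" using w B finB by auto
    ultimately show ?case by blast
  qed
  from this[of "card ?V"] obtain B x where B: "B \<subseteq> ?V" "card B = card ?V"
    and reach: "(topples_to G s)\<^sup>*\<^sup>* ?start x"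
    and x: "\<And>v. x v + (if v \<in> B then vdeg G v else 0) =
             e v + (if v \<in> ?V then 1 + card (neighbours G v \<inter> B) else 0)"
    by auto
  have "B = ?V" using B fin by (simp add: card_subset_eq)
  then have "x v = e v" for v using x[of v] deg[of v "?V"] by (cases "v \<in> ?V") auto
  then have "x = e" by blast
  then show ?thesis using reach by simp
qed

lemma no_forbidden_subset_imp_recurrent:
  assumes loopfree: "\<And>v. v \<notin> neighbours G v" and fin: "finite (fst G)"
    and s: "s \<in> fst G" and dominating: "fst G - {s} \<subseteq> neighbours G s"
    and st: "stable_config G s c" and nf: "no_forbidden_subset G s c"
  shows "recurrent_config G s c"
  unfolding recurrent_config_def
proof (intro conjI allI impI)
  show "stable_config G s c" by (rule st)
next
  fix d assume d: "configuration G s d"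
  let ?V = "fst G - {s}"
  have reach: "(topples_to G s)\<^sup>*\<^sup>* (\<lambda>v. c v + (if v \<in> ?V then k else 0)) c" for k
  proof (induction k)
    case 0
    show ?case by simp
  next
    case (Suc k)
    have "(topples_to G s)\<^sup>*\<^sup>* (\<lambda>v. (c v + (if v \<in> ?V then k else 0)) + (if v \<in> ?V then 1 else 0))
        (\<lambda>v. c v + (if v \<in> ?V then k else 0))"
      by (rule burning_returns[OF loopfree fin s dominating nf]) auto
    also have "(\<lambda>v. (c v + (if v \<in> ?V then k else 0)) + (if v \<in> ?V then 1 else 0)) =
        (\<lambda>v. c v + (if v \<in> ?V then Suc k else 0))" by auto
    finally show ?case using Suc.IH by (rule rtranclp_trans)
  qed
  \<comment> \<open>Any common bound of the values of \<open>d\<close> serves; the sum is one also when there is no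
    vertex besides the sink.\<close>
  define k where "k = (\<Sum>v\<in>?V. d v)"
  define e where "e = (\<lambda>v. c v + (if v \<in> ?V then k else 0) - d v)"
  have dk: "d v \<le> c v + (if v \<in> ?V then k else 0)" for v
  proof (cases "v \<in> ?V")
    case True
    then have "d v \<le> k" unfolding k_def using fin by (intro member_le_sum) auto
    then show ?thesis using True by simp
  next
    case False
    then show ?thesis using d unfolding configuration_def by simp
  qed
  have "configuration G s e"
    using st by (auto simp: configuration_def stable_config_def e_def)
  moreover have "(\<lambda>v. d v + e v) = (\<lambda>v. c v + (if v \<in> ?V then k else 0))"
    using dk by (auto simp: e_def fun_eq_iff simp del: Diff_iff)
  ultimately show "\<exists>e. configuration G s e \<and> stabilises_to G s (\<lambda>v. d v + e v) c"
    unfolding stabilises_to_def using reach st by metis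
qed

section \<open>The complete split graph\<close>

lemma neighbours_Clique:
  "i \<in> {1..m} \<Longrightarrow> neighbours (split_graph m n) (Clique i) = fst (split_graph m n) - {Clique i}"
  by (auto simp: neighbours_def split_graph_def doubleton_eq_iff) blast+

lemma neighbours_Indep:
  "j \<in> {1..n} \<Longrightarrow> neighbours (split_graph m n) (Indep j) = Clique ` {1..m}"
  by (auto simp: neighbours_def split_graph_def doubleton_eq_iff)

lemma split_graph_loopfree: "v \<notin> neighbours (split_graph m n) v"
  by (auto simp: neighbours_def split_graph_def doubleton_eq_iff)

lemma finite_split_graph: "finite (fst (split_graph m n))"
  by (simp add: split_graph_def)

lemma card_split_graph: "card (fst (split_graph m n)) = m + n"
  unfolding split_graph_def fst_conv
  by (subst card_Un_disjoint) (auto simp: card_image inj_on_def)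

lemma split_graph_nonsink:
  "fst (split_graph m n) - {Clique m} = Clique ` {1..m - 1} \<union> Indep ` {1..n}"
  by (force simp: split_graph_def)

lemma all_subset_vertices_iff:
  "(\<forall>A. A \<subseteq> Clique ` S \<union> Indep ` T \<longrightarrow> P A) \<longleftrightarrow>
   (\<forall>I J. I \<subseteq> S \<longrightarrow> J \<subseteq> T \<longrightarrow> P (Clique ` I \<union> Indep ` J))"
proof (intro iffI allI impI)
  fix A assume all: "\<forall>I J. I \<subseteq> S \<longrightarrow> J \<subseteq> T \<longrightarrow> P (Clique ` I \<union> Indep ` J)"
    and A: "A \<subseteq> Clique ` S \<union> Indep ` T"
  have "A = Clique ` (Clique -` A) \<union> Indep ` (Indep -` A)" using A by auto
  moreover have "Clique -` A \<subseteq> S" "Indep -` A \<subseteq> T" using A by auto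
  ultimately show "P A" using all by metis
next
  fix I J assume "\<forall>A. A \<subseteq> Clique ` S \<union> Indep ` T \<longrightarrow> P A" "I \<subseteq> S" "J \<subseteq> T"
  then show "P (Clique ` I \<union> Indep ` J)" by (meson Un_mono image_mono)
qed

text \<open>In the set made of \<open>I\<close> and \<open>J\<close>, a clique vertex is adjacent to all other members, and an
  independent vertex to the members in \<open>I\<close>.\<close>

lemma recurrent_split_graph_iff:
  assumes m: "m \<ge> 1" and st: "stable_config (split_graph m n) (Clique m) c"
  shows "recurrent_config (split_graph m n) (Clique m) c \<longleftrightarrow>
    (\<forall>I J. I \<subseteq> {1..m - 1} \<longrightarrow> J \<subseteq> {1..n} \<longrightarrow> I \<noteq> {} \<or> J \<noteq> {} \<longrightarrow>
       (\<exists>i\<in>I. card I + card J \<le> c (Clique i) + 1) \<or> (\<exists>j\<in>J. card I \<le> c (Indep j)))"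
    (is "_ \<longleftrightarrow> ?crit")
proof -
  let ?G = "split_graph m n"
  have dom: "Clique m \<in> fst ?G" "fst ?G - {Clique m} \<subseteq> neighbours ?G (Clique m)"
    using m by (simp add: split_graph_def) (use m in \<open>simp add: neighbours_Clique\<close>)
  have "recurrent_config ?G (Clique m) c \<longleftrightarrow> no_forbidden_subset ?G (Clique m) c"
  proof
    assume "recurrent_config ?G (Clique m) c"
    then show "no_forbidden_subset ?G (Clique m) c"
      by (rule recurrent_imp_no_forbidden_subset[rotated 2])
         (rule split_graph_loopfree finite_split_graph)+
  next
    assume "no_forbidden_subset ?G (Clique m) c"
    then show "recurrent_config ?G (Clique m) c"
      by (rule no_forbidden_subset_imp_recurrent[rotated 5])
         (rule split_graph_loopfree finite_split_graph dom st)+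
  qed
  also have "\<dots> \<longleftrightarrow> (\<forall>I J. I \<subseteq> {1..m - 1} \<longrightarrow> J \<subseteq> {1..n} \<longrightarrow> Clique ` I \<union> Indep ` J \<noteq> {} \<longrightarrow>
      (\<exists>v \<in> Clique ` I \<union> Indep ` J.
         card (neighbours ?G v \<inter> (Clique ` I \<union> Indep ` J)) \<le> c v))"
    unfolding no_forbidden_subset_def split_graph_nonsink all_subset_vertices_iff ..
  also have "\<dots> \<longleftrightarrow> ?crit"
  proof -
    have "(\<exists>v \<in> Clique ` I \<union> Indep ` J. card (neighbours ?G v \<inter> (Clique ` I \<union> Indep ` J)) \<le> c v)
       \<longleftrightarrow> (\<exists>i\<in>I. card I + card J \<le> c (Clique i) + 1) \<or> (\<exists>j\<in>J. card I \<le> c (Indep j))"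
      if IJ: "I \<subseteq> {1..m - 1}" "J \<subseteq> {1..n}" for I J
    proof -
      let ?A = "Clique ` I \<union> Indep ` J"
      have fin: "finite I" "finite J" using IJ finite_subset by blast+
      have cA: "card ?A = card I + card J"
        using fin by (subst card_Un_disjoint) (auto simp: card_image inj_on_def)
      have sub: "?A \<subseteq> fst ?G" using IJ by (force simp: split_graph_def)
      have C: "card (neighbours ?G (Clique i) \<inter> ?A) = card I + card J - 1" if "i \<in> I" for i
      proof -
        have "i \<in> {1..m}" using that IJ by force
        then have "neighbours ?G (Clique i) \<inter> ?A = ?A - {Clique i}"
          using sub neighbours_Clique by blast
        then show ?thesis using that cA fin by (simp add: card_Diff_singleton)
      qed
      have E: "card (neighbours ?G (Indep j) \<inter> ?A) = card I" if "j \<in> J" for j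
      proof -
        have "neighbours ?G (Indep j) \<inter> ?A = Clique ` I"
          using IJ that by (subst neighbours_Indep) force+
        then show ?thesis by (simp add: card_image inj_on_def)
      qed
      show ?thesis using C E by (auto simp: bex_Un le_diff_conv)
    qed
    then show ?thesis by auto
  qed
  finally show ?thesis .
qed

section \<open>Words with prescribed heights\<close>

lemma after_nth_split:
  "count_list u x = k \<Longrightarrow> after_nth (Suc k) x (u @ x # v) = v"
proof (induction u arbitrary: k)
  case (Cons y u)
  then show ?case by (cases k) (auto split: if_splits)
qed simp

lemma split_at_nth:
  "k < count_list w x \<Longrightarrow> \<exists>u v. w = u @ x # v \<and> count_list u x = k"
proof (induction w arbitrary: k)
  case (Cons y w)
  show ?case
  proof (cases "y = x \<and> k = 0")
    case True
    then show ?thesis by (intro exI[of _ "[]"] exI[of _ w]) simp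
  next
    case False
    let ?k = "if y = x then k - 1 else k"
    have "?k < count_list w x" using Cons.prems False by auto
    then obtain u v where "w = u @ x # v" "count_list u x = ?k" using Cons.IH by blast
    then show ?thesis using False by (intro exI[of _ "y # u"] exI[of _ v]) auto
  qed
qed simp

lemma after_nth_Cons_same: "after_nth (Suc i) x (x # w) = after_nth i x w"
  by simp

lemma after_nth_Cons_other: "y \<noteq> x \<Longrightarrow> after_nth (Suc i) x (y # w) = after_nth (Suc i) x w"
  by simp

lemma count_after_nth_le: "count_list (after_nth i x w) y \<le> count_list w y"
proof (induction i arbitrary: w)
  case (Suc i)
  have "count_list (tl (dropWhile P w)) y \<le> count_list w y" for P
    by (induction w) auto
  then show ?case using Suc.IH le_trans unfolding after_nth.simps by blast
qed simp

text \<open>The letters \<open>D\<close> and \<open>H\<close> are the events of the burning process at which a vertex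
  burns.\<close>

abbreviation burns :: "letter list \<Rightarrow> nat" where
  "burns w \<equiv> count_list w D + count_list w H"

text \<open>A word containing \<open>U\<close> begins with it exactly if all burning letters come after its first
  \<open>U\<close>, and a word containing \<open>H\<close> that does not begin with \<open>U\<close> begins with \<open>H\<close> exactly if all
  letters \<open>D\<close> come after its first \<open>H\<close>. Exchanging the two words covers all the ways in which the
  first letters could differ.\<close>

lemma first_letters_agree:
  assumes cnt: "\<And>z. count_list (x # w) z = count_list (y # w') z"
    and U: "count_list (x # w) U > 0 \<Longrightarrow>
          burns (after_nth (Suc 0) U (x # w)) = burns (after_nth (Suc 0) U (y # w'))"
    and H: "count_list (x # w) H > 0 \<Longrightarrow>
          count_list (after_nth (Suc 0) H (x # w)) D = count_list (after_nth (Suc 0) H (y # w')) D"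
  shows "\<not> (x = U \<and> y \<noteq> U \<or> x = H \<and> y = D)"
proof
  assume "x = U \<and> y \<noteq> U \<or> x = H \<and> y = D"
  then consider "x = U" "y \<noteq> U" | "x = H" "y = D" by blast
  then show False
  proof cases
    case 1
    have "burns w = burns (after_nth (Suc 0) U w')" using U 1 by simp
    also have "\<dots> \<le> burns w'" by (intro add_mono count_after_nth_le)
    also have "\<dots> < burns (y # w')" using 1 by (cases y) auto
    also have "\<dots> = burns w" using cnt[of D] cnt[of H] 1 by simp
    finally show False by simp
  next
    case 2
    have "count_list w D = count_list (after_nth (Suc 0) H w') D" using H 2 by simp
    also have "\<dots> \<le> count_list w' D" by (rule count_after_nth_le)
    also have "\<dots> < count_list w D" using cnt[of D] 2 by simp
    finally show False by simp
  qed
qed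

lemma word_eqI:
  assumes "\<And>x. count_list w x = count_list w' x"
    and "\<And>i. i < count_list w U \<Longrightarrow>
          burns (after_nth (Suc i) U w) = burns (after_nth (Suc i) U w')"
    and "\<And>j. j < count_list w H \<Longrightarrow>
          count_list (after_nth (Suc j) H w) D = count_list (after_nth (Suc j) H w') D"
  shows "w = w'"
  using assms
proof (induction w arbitrary: w')
  case Nil
  have "count_list w' (hd w') = 0" using Nil.prems(1)[of "hd w'"] by simp
  then show ?case by (cases w') auto
next
  case (Cons x w v)
  obtain y w' where v: "v = y # w'"
    using Cons.prems(1)[of x] by (cases v) auto
  note cnt = Cons.prems(1)[unfolded v]
  have "x = y"
  proof (rule ccontr)
    assume "x \<noteq> y"
    then consider "x = U \<and> y \<noteq> U \<or> x = H \<and> y = D" | "y = U \<and> x \<noteq> U \<or> y = H \<and> x = D"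
      by (cases x; cases y) auto
    then show False
    proof cases
      case 1
      then show False
        using first_letters_agree[of x w y w'] Cons.prems(2,3)[of 0] cnt v by auto
    next
      case 2
      then show False
        using first_letters_agree[of y w' x w] Cons.prems(2,3)[of 0] cnt v by auto
    qed
  qed
  have "w = w'"
  proof (rule Cons.IH)
    show "count_list w z = count_list w' z" for z
      using cnt[of z] \<open>x = y\<close> by (simp split: if_splits)
  next
    fix i assume "i < count_list w U"
    then show "burns (after_nth (Suc i) U w) = burns (after_nth (Suc i) U w')"
      using Cons.prems(2)[of "if x = U then Suc i else i"] \<open>x = y\<close> v
      by (cases "y = U") (simp_all del: after_nth.simps add: after_nth_Cons_same after_nth_Cons_other)
  next
    fix i assume "i < count_list w H"
    then show "count_list (after_nth (Suc i) H w) D = count_list (after_nth (Suc i) H w') D"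
      using Cons.prems(3)[of "if x = H then Suc i else i"] \<open>x = y\<close> v
      by (cases "y = H") (simp_all del: after_nth.simps add: after_nth_Cons_same after_nth_Cons_other)
  qed
  then show ?case using v \<open>x = y\<close> by simp
qed

text \<open>The word is built greedily: \<open>U\<close> if the largest \<open>a\<close> counts all burning letters to come,
  otherwise \<open>H\<close> if the largest \<open>b\<close> counts all letters \<open>D\<close> to come, otherwise \<open>D\<close>. The upper
  bounds on the heights are preserved because \<open>H\<close> and \<open>D\<close> are only chosen when every height that
  they could violate is strictly below its bound; when \<open>D\<close> is chosen before the end,
  this forces \<open>d\<close> to be positive.
  The numbers of \<open>U\<close> and \<open>D\<close> are independent here, since removing a letter unbalances them.\<close>

lemma word_exists:
  fixes a b :: "nat \<Rightarrow> nat"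
  assumes "\<And>i j. i \<le> j \<Longrightarrow> j < k \<Longrightarrow> a j \<le> a i" and "\<And>i. i < k \<Longrightarrow> a i \<le> d + n"
    and "\<And>i j. i \<le> j \<Longrightarrow> j < n \<Longrightarrow> b j \<le> b i" and "\<And>i. i < n \<Longrightarrow> b i \<le> d"
  shows "\<exists>w. count_list w U = k \<and> count_list w D = d \<and> count_list w H = n \<and>
     (\<forall>i<k. burns (after_nth (Suc i) U w) = a i) \<and>
     (\<forall>j<n. count_list (after_nth (Suc j) H w) D = b j)"
  using assms
proof (induction "k + d + n" arbitrary: k d n a b)
  case 0
  show ?case using "0.hyps" by (intro exI[of _ "[]"]) simp
next
  case (Suc N)
  note an = Suc.prems(1) and ale = Suc.prems(2) and bn = Suc.prems(3) and ble = Suc.prems(4)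
  consider (U) "k > 0" "a 0 = d + n"
    | (H) "\<And>i. i < k \<Longrightarrow> a i < d + n" "n > 0" "b 0 = d"
    | (D) "\<And>i. i < k \<Longrightarrow> a i < d + n" "\<And>j. j < n \<Longrightarrow> b j < d"
  proof (cases "k > 0 \<and> a 0 = d + n")
    case False
    have lt: "a i < d + n" if "i < k" for i
      using an[of 0 i] ale[of 0] that False by force
    show ?thesis
    proof (cases "n > 0 \<and> b 0 = d")
      case True
      then show ?thesis using H lt by blast
    next
      case nH: False
      have "b j < d" if "j < n" for j
        using bn[of 0 j] ble[of 0] that nH by force
      then show ?thesis using D lt by blast
    qed
  qed (use U in blast)
  then show ?case
  proof cases
    case U
    then obtain k' where k: "k = Suc k'" using gr0_implies_Suc by blast
    have "\<exists>w. count_list w U = k' \<and> count_list w D = d \<and> count_list w H = n \<and>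
     (\<forall>i<k'. burns (after_nth (Suc i) U w) = a (Suc i)) \<and>
     (\<forall>j<n. count_list (after_nth (Suc j) H w) D = b j)"
      by (rule Suc.hyps(1)) (use Suc.hyps(2) k an ale bn ble in auto)
    then obtain w where w: "count_list w U = k'" "count_list w D = d" "count_list w H = n"
      "\<And>i. i < k' \<Longrightarrow> burns (after_nth (Suc i) U w) = a (Suc i)"
      "\<And>j. j < n \<Longrightarrow> count_list (after_nth (Suc j) H w) D = b j" by blast
    have "burns (after_nth (Suc i) U (U # w)) = a i" if "i < k" for i
      using w U(2) that k by (cases i) (simp_all del: after_nth.simps(2) add: after_nth_Cons_same)
    then show ?thesis using w k by (intro exI[of _ "U # w"]) simp
  next
    case H
    then obtain n' where n: "n = Suc n'" using gr0_implies_Suc by blast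
    have "\<exists>w. count_list w U = k \<and> count_list w D = d \<and> count_list w H = n' \<and>
     (\<forall>i<k. burns (after_nth (Suc i) U w) = a i) \<and>
     (\<forall>j<n'. count_list (after_nth (Suc j) H w) D = b (Suc j))"
      by (rule Suc.hyps(1)) (use Suc.hyps(2) n an H(1) bn ble in \<open>auto simp: less_Suc_eq_le\<close>)
    then obtain w where w: "count_list w U = k" "count_list w D = d" "count_list w H = n'"
      "\<And>i. i < k \<Longrightarrow> burns (after_nth (Suc i) U w) = a i"
      "\<And>j. j < n' \<Longrightarrow> count_list (after_nth (Suc j) H w) D = b (Suc j)" by blast
    have "count_list (after_nth (Suc j) H (H # w)) D = b j" if "j < n" for j
      using w H(3) that n by (cases j) (simp_all del: after_nth.simps(2) add: after_nth_Cons_same)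
    then show ?thesis using w n by (intro exI[of _ "H # w"]) simp
  next
    case D
    have "d > 0" using Suc.hyps(2) D(1)[of 0] D(2)[of 0] by (cases "n > 0"; cases "k > 0") auto
    then obtain d' where d: "d = Suc d'" using gr0_implies_Suc by blast
    have "\<exists>w. count_list w U = k \<and> count_list w D = d' \<and> count_list w H = n \<and>
     (\<forall>i<k. burns (after_nth (Suc i) U w) = a i) \<and>
     (\<forall>j<n. count_list (after_nth (Suc j) H w) D = b j)"
      by (rule Suc.hyps(1)) (use Suc.hyps(2) d an D bn in \<open>auto simp: less_Suc_eq_le\<close>)
    then obtain w where w: "count_list w U = k" "count_list w D = d'" "count_list w H = n"
      "\<And>i. i < k \<Longrightarrow> burns (after_nth (Suc i) U w) = a i"
      "\<And>j. j < n \<Longrightarrow> count_list (after_nth (Suc j) H w) D = b j" by blast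
    then show ?thesis using d by (intro exI[of _ "D # w"]) simp
  qed
qed

section \<open>The prefix condition and burning\<close>

lemma motzkin_prefix_le: "motzkin_word (u @ v) \<Longrightarrow> count_list u D \<le> count_list u U"
  by (simp add: motzkin_word_def)

text \<open>By the prefix condition every \<open>U\<close> has a \<open>D\<close> after it, so that the truncated subtraction in
  \<open>motzkin_config\<close> loses no information.\<close>

lemma motzkin_burns_pos:
  assumes "motzkin_word w" "i < count_list w U"
  shows "burns (after_nth (Suc i) U w) > 0"
proof -
  obtain u v where w: "w = u @ U # v" "count_list u U = i"
    using split_at_nth[OF assms(2)] by blast
  have "count_list u D \<le> count_list u U" using assms(1) w motzkin_prefix_le by blast
  moreover have "count_list w U = count_list w D" using assms(1) by (simp add: motzkin_word_def)
  ultimately have "count_list v D > 0" using w(1) by simp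
  then show ?thesis using w by (simp add: after_nth_split del: after_nth.simps)
qed

text \<open>Which alternative holds depends on the order of the \<open>p\<close>-th \<open>D\<close> and the \<open>q\<close>-th \<open>H\<close>,
  counted from the right. If that \<open>H\<close> comes first, all \<open>p\<close> letters \<open>D\<close> follow it. If that \<open>D\<close>
  comes first, then by the prefix condition the \<open>U\<close> of the same rank stands even before it, and
  all \<open>p + q\<close> letters follow.\<close>

lemma motzkin_burnable:
  assumes mot: "motzkin_word w" and p: "p \<le> count_list w U" and q: "q \<le> count_list w H"
    and pq: "p > 0 \<or> q > 0"
  shows "(p > 0 \<and> p + q \<le> burns (after_nth (Suc (count_list w U - p)) U w)) \<or>
         (q > 0 \<and> p \<le> count_list (after_nth (Suc (count_list w H - q)) H w) D)"
proof (cases "p = 0")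
  case True
  then show ?thesis using pq by simp
next
  case False
  have UD: "count_list w U = count_list w D" using mot by (simp add: motzkin_word_def)
  then have "count_list w U - p < count_list w D" using False p by simp
  then obtain x y where w: "w = x @ D # y" and cx: "count_list x D = count_list w U - p"
    by (blast dest: split_at_nth)
  have cy: "count_list y D + 1 = p"
    using w cx p UD by simp
  show ?thesis
  proof (cases "q \<le> count_list y H")
    case True
    have "count_list (x @ [D]) D \<le> count_list (x @ [D]) U"
      using motzkin_prefix_le[of "x @ [D]" y] mot w by simp
    then have "count_list w U - p < count_list x U" using cx by simp
    then obtain x1 x2 where x: "x = x1 @ U # x2" "count_list x1 U = count_list w U - p"
      by (blast dest: split_at_nth)
    have "after_nth (Suc (count_list w U - p)) U w = x2 @ D # y"
      using after_nth_split[OF x(2), of "x2 @ D # y"] w x(1) by simp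
    then show ?thesis using cy True False by simp
  next
    case nle: False
    have "count_list w H = count_list x H + count_list y H" using w by simp
    then have "count_list w H - q < count_list x H" using nle q by simp
    then obtain x1 x2 where x: "x = x1 @ H # x2" "count_list x1 H = count_list w H - q"
      by (blast dest: split_at_nth)
    have "after_nth (Suc (count_list w H - q)) H w = x2 @ D # y"
      using after_nth_split[OF x(2), of "x2 @ D # y"] w x(1) by simp
    then show ?thesis using cy nle by simp
  qed
qed

lemma after_nth_append:
  "count_list u x \<le> i \<Longrightarrow> after_nth (Suc i) x (u @ v) = after_nth (Suc (i - count_list u x)) x v"
proof (induction u arbitrary: i)
  case (Cons y u)
  show ?case
  proof (cases "y = x")
    case True
    then obtain i' where "i = Suc i'" using Cons.prems by (cases i) auto
    then show ?thesis using True Cons by (simp add: after_nth_Cons_same del: after_nth.simps)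
  next
    case False
    then show ?thesis using Cons by (simp add: after_nth_Cons_other del: after_nth.simps)
  qed
qed simp

text \<open>Consider the shortest prefix that violates the condition. It ends with a \<open>D\<close>. Let \<open>p\<close> count
  this \<open>D\<close> and those after it, and \<open>q\<close> the letters \<open>H\<close> after it. The last \<open>p\<close> letters \<open>U\<close> and
  the last \<open>q\<close> letters \<open>H\<close> all lie after this \<open>D\<close>, so they have at most \<open>p + q - 1\<close> burning
  letters, respectively \<open>p - 1\<close> letters \<open>D\<close>, behind them.\<close>

lemma motzkinI:
  assumes UD: "count_list w U = count_list w D"
    and burn: "\<And>p q. 0 < p \<Longrightarrow> p \<le> count_list w U \<Longrightarrow> q \<le> count_list w H \<Longrightarrow>
      (\<exists>i < count_list w U. count_list w U - p \<le> i \<and> p + q \<le> burns (after_nth (Suc i) U w)) \<or>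
      (\<exists>j < count_list w H. count_list w H - q \<le> j \<and> p \<le> count_list (after_nth (Suc j) H w) D)"
  shows "motzkin_word w"
proof -
  have "count_list u D \<le> count_list u U" if "w = u @ v" for u v
    using that
  proof (induction u arbitrary: v rule: rev_induct)
    case (snoc z x)
    have IH: "count_list x D \<le> count_list x U" using snoc.IH[of "z # v"] snoc.prems by simp
    show ?case
    proof (rule ccontr)
      assume *: "\<not> ?thesis"
      then have z: "z = D" and eq: "count_list x D = count_list x U"
        using IH by (auto split: if_splits)
      have w: "w = (x @ [D]) @ v" using snoc.prems z by simp
      define p q where "p = count_list v D + 1" and "q = count_list v H"
      have pU: "count_list w U - p = count_list x U" "p \<le> count_list w U"
        and qH: "count_list w H - q = count_list x H" "q \<le> count_list w H"
        using UD eq by (auto simp: w p_def q_def)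
      have late_U: "burns (after_nth (Suc i) U w) < p + q" if "count_list x U \<le> i" for i
        using that count_after_nth_le[of "Suc (i - count_list x U)" U v D]
          count_after_nth_le[of "Suc (i - count_list x U)" U v H]
          after_nth_append[of "x @ [D]" U i v]
        by (simp add: w p_def q_def del: after_nth.simps append_assoc)
      have late_H: "count_list (after_nth (Suc j) H w) D < p" if "count_list x H \<le> j" for j
        using that count_after_nth_le[of "Suc (j - count_list x H)" H v D]
          after_nth_append[of "x @ [D]" H j v]
        by (simp add: w p_def del: after_nth.simps append_assoc)
      have "0 < p" by (simp add: p_def)
      from burn[OF this pU(2) qH(2)] show False
        unfolding pU(1) qH(1) using late_U late_H by (meson not_le)
    qed
  qed simp
  then show ?thesis using UD by (auto simp: motzkin_word_def prefix_def)
qed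

section \<open>Recurrent configurations and Motzkin words\<close>

text \<open>For weakly decreasing heights, this reduces a set of vertices to the set of the same size
  with the largest indices.\<close>

lemma exists_le_of_card:
  assumes "I \<subseteq> {1..k}" "I \<noteq> {}"
  shows "\<exists>i\<in>I. i \<le> Suc (k - card I)"
proof (rule ccontr)
  assume "\<not> ?thesis"
  then have "I \<subseteq> {Suc (Suc (k - card I))..k}" using assms(1) by force
  then have "card I \<le> card {Suc (Suc (k - card I))..k}" by (intro card_mono) auto
  moreover have "card I > 0" using assms finite_subset by (auto simp: card_gt_0_iff)
  moreover have "card I \<le> k" using card_mono[OF _ assms(1)] by simp
  ultimately show False by simp
qed

lemma ball_atLeast1_iff: "(\<forall>i\<in>{1..k}. P i) \<longleftrightarrow> (\<forall>i<k. P (Suc i))" for k :: nat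
  unfolding image_Suc_lessThan[symmetric] by auto

lemma motzkin_config_eq_iff:
  assumes conf: "configuration (split_graph m n) (Clique m) c" and w: "w \<in> Motzkin (m - 1) n"
  shows "motzkin_config m n w = c \<longleftrightarrow>
    (\<forall>i < m - 1. burns (after_nth (Suc i) U w) = c (Clique (Suc i)) + 1) \<and>
    (\<forall>j < n. count_list (after_nth (Suc j) H w) D = c (Indep (Suc j)))"
proof -
  have pos: "burns (after_nth (Suc i) U w) > 0" if "i < m - 1" for i
    using w that motzkin_burns_pos[of w i] by (simp add: Motzkin_def del: after_nth.simps)
  have zero: "c (Clique i) = 0" if "i \<notin> {1..m - 1}" for i
    using conf that unfolding configuration_def split_graph_nonsink by blast
  have zero': "c (Indep j) = 0" if "j \<notin> {1..n}" for j
    using conf that unfolding configuration_def split_graph_nonsink by blast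
  have "motzkin_config m n w = c \<longleftrightarrow>
      (\<forall>i. motzkin_config m n w (Clique i) = c (Clique i)) \<and>
      (\<forall>j. motzkin_config m n w (Indep j) = c (Indep j))"
    by (auto simp: fun_eq_iff) (metis vertex.exhaust)
  also have "(\<forall>i. motzkin_config m n w (Clique i) = c (Clique i)) \<longleftrightarrow>
      (\<forall>i\<in>{1..m - 1}. burns (after_nth i U w) - 1 = c (Clique i))"
    using zero by (auto simp: motzkin_config_def)
  also have "\<dots> \<longleftrightarrow> (\<forall>i<m - 1. burns (after_nth (Suc i) U w) - 1 = c (Clique (Suc i)))"
    by (rule ball_atLeast1_iff)
  also have "\<dots> \<longleftrightarrow> (\<forall>i<m - 1. burns (after_nth (Suc i) U w) = c (Clique (Suc i)) + 1)"
    using pos by (metis Suc_diff_1 Suc_eq_plus1 diff_Suc_1)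
  also have "(\<forall>j. motzkin_config m n w (Indep j) = c (Indep j)) \<longleftrightarrow>
      (\<forall>j\<in>{1..n}. count_list (after_nth j H w) D = c (Indep j))"
    using zero' by (auto simp: motzkin_config_def)
  also have "\<dots> \<longleftrightarrow> (\<forall>j<n. count_list (after_nth (Suc j) H w) D = c (Indep (Suc j)))"
    by (rule ball_atLeast1_iff)
  finally show ?thesis .
qed

theorem theorem3p3:
  fixes m n :: nat and c :: "vertex \<Rightarrow> nat"
  assumes "m \<ge> 1" and "n \<ge> 1"
    and "stable_config (split_graph m n) (Clique m) c"
    and "weakly_decreasing m n c"
  shows "recurrent_config (split_graph m n) (Clique m) c \<longleftrightarrow>
         (\<exists>!\<alpha>. \<alpha> \<in> Motzkin (m - 1) n \<and> motzkin_config m n \<alpha> = c)"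
proof -
  let ?G = "split_graph m n"
  have conf: "configuration ?G (Clique m) c"
    using assms(3) by (simp add: stable_config_def)
  have cC: "c (Clique i) + 1 \<le> m - 1 + n" if "i \<in> {1..m - 1}" for i
  proof -
    have "Clique i \<in> fst ?G - {Clique m}" unfolding split_graph_nonsink using that by blast
    then have "c (Clique i) < vdeg ?G (Clique i)" using assms(3) unfolding stable_config_def by blast
    also have "vdeg ?G (Clique i) = m + n - 1"
    proof -
      have i: "i \<in> {1..m}" using that by auto
      then have "Clique i \<in> fst ?G" by (simp add: split_graph_def)
      then show ?thesis
        unfolding vdeg_def neighbours_Clique[OF i] by (simp add: card_split_graph)
    qed
    finally show ?thesis using that by simp
  qed
  have cI: "c (Indep j) \<le> m - 1" if "j \<in> {1..n}" for j
  proof -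
    have "Indep j \<in> fst ?G - {Clique m}" unfolding split_graph_nonsink using that by blast
    then have "c (Indep j) < vdeg ?G (Indep j)" using assms(3) unfolding stable_config_def by blast
    then show ?thesis
      using that by (simp add: vdeg_def neighbours_Indep card_image inj_on_def)
  qed
  have decC: "c (Clique j) \<le> c (Clique i)" if "1 \<le> i" "i \<le> j" "j \<le> m - 1" for i j
    using assms(4) that unfolding weakly_decreasing_def monotone_on_def by simp
  have decI: "c (Indep j) \<le> c (Indep i)" if "1 \<le> i" "i \<le> j" "j \<le> n" for i j
    using assms(4) that unfolding weakly_decreasing_def monotone_on_def by simp
  note config_iff = motzkin_config_eq_iff[OF conf]
  show ?thesis
  proof
    assume rec: "recurrent_config ?G (Clique m) c"
    obtain w where w: "count_list w U = m - 1" "count_list w D = m - 1" "count_list w H = n"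
      and wU: "\<And>i. i < m - 1 \<Longrightarrow> burns (after_nth (Suc i) U w) = c (Clique (Suc i)) + 1"
      and wH: "\<And>j. j < n \<Longrightarrow> count_list (after_nth (Suc j) H w) D = c (Indep (Suc j))"
      using word_exists[of "m - 1" "\<lambda>i. c (Clique (Suc i)) + 1" "m - 1" n "\<lambda>j. c (Indep (Suc j))"]
        cC cI decC decI by fastforce
    have "motzkin_word w"
    proof (rule motzkinI)
      fix p q assume pq: "0 < p" "p \<le> count_list w U" "q \<le> count_list w H"
      \<comment> \<open>The vertices that belong to the last \<open>p\<close> letters \<open>U\<close> and the last \<open>q\<close> letters \<open>H\<close>.\<close>
      let ?I = "{Suc (m - 1 - p)..m - 1}" and ?J = "{Suc (n - q)..n}"
      have card: "card ?I = p" "card ?J = q" using pq w by auto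
      have "(\<exists>i\<in>?I. p + q \<le> c (Clique i) + 1) \<or> (\<exists>j\<in>?J. p \<le> c (Indep j))"
        using rec[unfolded recurrent_split_graph_iff[OF assms(1,3)], rule_format, of ?I ?J]
          pq w unfolding card by force
      then show "(\<exists>i < count_list w U. count_list w U - p \<le> i \<and> p + q \<le> burns (after_nth (Suc i) U w)) \<or>
        (\<exists>j < count_list w H. count_list w H - q \<le> j \<and> p \<le> count_list (after_nth (Suc j) H w) D)"
      proof (elim disjE bexE)
        fix i assume i: "i \<in> ?I" "p + q \<le> c (Clique i) + 1"
        then show ?thesis using wU[of "i - 1"] w by (intro disjI1 exI[of _ "i - 1"]) auto
      next
        fix j assume j: "j \<in> ?J" "p \<le> c (Indep j)"
        then show ?thesis using wH[of "j - 1"] w by (intro disjI2 exI[of _ "j - 1"]) auto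
      qed
    qed (use w in simp)
    then have wM: "w \<in> Motzkin (m - 1) n" using w by (simp add: Motzkin_def)
    show "\<exists>!\<alpha>. \<alpha> \<in> Motzkin (m - 1) n \<and> motzkin_config m n \<alpha> = c"
    proof (intro ex1I conjI)
      show "motzkin_config m n w = c" using config_iff[OF wM] wU wH by blast
    next
      fix v assume v: "v \<in> Motzkin (m - 1) n \<and> motzkin_config m n v = c"
      then have vU: "\<And>i. i < m - 1 \<Longrightarrow> burns (after_nth (Suc i) U v) = c (Clique (Suc i)) + 1"
        and vH: "\<And>j. j < n \<Longrightarrow> count_list (after_nth (Suc j) H v) D = c (Indep (Suc j))"
        using config_iff by blast+
      have vc: "count_list v U = m - 1" "count_list v D = m - 1" "count_list v H = n"
        using v by (auto simp: Motzkin_def motzkin_word_def)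
      show "v = w"
      proof (rule word_eqI)
        show "count_list v x = count_list w x" for x using vc w by (cases x) auto
      qed (use vc vU vH wU wH in auto)
    qed (rule wM)
  next
    assume "\<exists>!\<alpha>. \<alpha> \<in> Motzkin (m - 1) n \<and> motzkin_config m n \<alpha> = c"
    then obtain w where wM: "w \<in> Motzkin (m - 1) n" and wc: "motzkin_config m n w = c" by blast
    have wU: "\<And>i. i < m - 1 \<Longrightarrow> burns (after_nth (Suc i) U w) = c (Clique (Suc i)) + 1"
      and wH: "\<And>j. j < n \<Longrightarrow> count_list (after_nth (Suc j) H w) D = c (Indep (Suc j))"
      using config_iff[OF wM] wc by blast+
    have w: "motzkin_word w" "count_list w U = m - 1" "count_list w H = n"
      using wM by (auto simp: Motzkin_def)
    show "recurrent_config ?G (Clique m) c"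
      unfolding recurrent_split_graph_iff[OF assms(1,3)]
    proof (intro allI impI)
      fix I J assume I: "I \<subseteq> {1..m - 1}" and J: "J \<subseteq> {1..n}" and ne: "I \<noteq> {} \<or> J \<noteq> {}"
      let ?p = "card I" and ?q = "card J"
      have fin: "finite I" "finite J" using I J finite_subset by blast+
      have le: "?p \<le> m - 1" "?q \<le> n" using card_mono[OF _ I] card_mono[OF _ J] by auto
      have "?p > 0 \<or> ?q > 0" using ne fin by (auto simp: card_gt_0_iff)
      then consider
          (clique) "?p > 0" "?p + ?q \<le> burns (after_nth (Suc (m - 1 - ?p)) U w)"
        | (indep) "?q > 0" "?p \<le> count_list (after_nth (Suc (n - ?q)) H w) D"
        using motzkin_burnable[OF w(1), of ?p ?q] w le by auto
      then show "(\<exists>i\<in>I. ?p + ?q \<le> c (Clique i) + 1) \<or> (\<exists>j\<in>J. ?p \<le> c (Indep j))"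
      proof cases
        case clique
        then obtain i where i: "i \<in> I" "i \<le> Suc (m - 1 - ?p)"
          using exists_le_of_card[OF I] by fastforce
        have "?p + ?q \<le> c (Clique (Suc (m - 1 - ?p))) + 1"
          using clique wU[of "m - 1 - ?p"] le by simp
        also have "c (Clique (Suc (m - 1 - ?p))) \<le> c (Clique i)"
          using i I clique(1) le by (intro decC) auto
        finally show ?thesis using i by auto
      next
        case indep
        then obtain j where j: "j \<in> J" "j \<le> Suc (n - ?q)"
          using exists_le_of_card[OF J] by fastforce
        have "?p \<le> c (Indep (Suc (n - ?q)))" using indep wH[of "n - ?q"] le by simp
        also have "\<dots> \<le> c (Indep j)"
          using j J indep(1) le by (intro decI) auto
        finally show ?thesis using j by auto
      qed
    qed
  qed
qed

end
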